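(* Let $\phi:X\to\mathcal H$ be a lower semi-frame of $\mathcal H$. Let $\psi:X\to\mathcal H$ be the function defined by $\psi_x=\mathsf T_\phi^{-1}P_\phi\phi_x$ for $x\in X$, where $P_\phi:\mathcal H\to\mathcal H_\phi$ is the orthogonal projection of $\mathcal H$ onto $\mathcal H_\phi$. The following statements hold. (1) $\psi$ is a weakly measurable function. (2) $\psi$ is a Bessel mapping of $\mathcal H$. (3) $\psi$ is dual to $\phi$, i.e. $f=\int_X\langle f|\phi_x\rangle\psi_x\,d\mu(x)$ for all $f\in D(C_\phi)$ in the weak sense, meaning that $\langle f|h\rangle=\int_X\langle f|\phi_x\rangle\langle\psi_x|h\rangle\,d\mu(x)$ for all $f\in D(C_\phi)$ and $h\in\mathcal H$. (4) If $D(C_\phi)$ is dense in $\mathcal H$, then $\psi$ is an upper semi-frame of $\mathcal H$.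
   Context: $\mathcal H$ is a separable Hilbert space with inner product $\langle\cdot|\cdot\rangle$ linear in the first factor, and $(X,\mu)$ is a locally compact space with a Radon measure $\mu$. A function $\phi:X\to\mathcal H$, $x\mapsto\phi_x$, is weakly measurable if $x\mapsto\langle f|\phi_x\rangle$ is measurable for every $f\in\mathcal H$. A weakly measurable function $\phi$ is: $\mu$-total if $\langle f|\phi_x\rangle=0$ for a.e. $x\in X$ implies $f=0$; a Bessel mapping of $\mathcal H$ if there is $\mathsf M<\infty$ with $\int_X|\langle f|\phi_x\rangle|^2d\mu(x)\le\mathsf M\|f\|^2$ for all $f\in\mathcal H$; an upper semi-frame of $\mathcal H$ if it is a $\mu$-total Bessel mapping, i.e. there is $\mathsf M<\infty$ with $0<\int_X|\langle f|\phi_x\rangle|^2d\mu(x)\le\mathsf M\|f\|^2$ for all $f\in\mathcal H$, $f\ne0$; a lower semi-frame of $\mathcal H$ if there is $\mathsf m>0$ with $\mathsf m\|f\|^2\le\int_X|\langle f|\phi_x\rangle|^2d\mu(x)$ for all $f\in\mathcal H$ (the integral may be $+\infty$). The analysis operator is $C_\phi:D(C_\phi)\subseteq\mathcal H\to L^2(X,d\mu)$, with $D(C_\phi)=\{f\in\mathcal H:\int_X|\langle f|\phi_x\rangle|^2d\mu(x)<\infty\}$ and $(C_\phi f)(x)=\langle f|\phi_x\rangle$; it is closed. $\mathcal H_\phi$ is the closure of $D(C_\phi)$ in $\mathcal H$. The generalized frame operator $\mathsf T_\phi$ is the non-negative self-adjoint operator in $\mathcal H_\phi$ associated by Kato's representation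 theorem to the closed non-negative form $\Omega_\phi(f,g)=\int_X\langle f|\phi_x\rangle\langle\phi_x|g\rangle\,d\mu(x)$, $f,g\in D(C_\phi)$; that is, $D(\mathsf T_\phi)\subset D(C_\phi)=D(\mathsf T_\phi^{1/2})$, $\Omega_\phi(f,g)=\langle\mathsf T_\phi f|g\rangle$ for $f\in D(\mathsf T_\phi)$, $g\in D(C_\phi)$, and $\mathsf T_\phi=C_\phi^\times C_\phi$, where $C_\phi^\times$ is the adjoint of $C_\phi$ regarded as an operator from $\mathcal H_\phi$ to $L^2(X,\mu)$. When $\phi$ is a lower semi-frame, $\mathsf T_\phi$ is invertible with $\mathsf T_\phi^{-1}$ a bounded operator defined on all of $\mathcal H_\phi$. *)

theory Defs
  imports "HOL-Analysis.Analysis"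
begin

section \<open>Complex Hilbert spaces\<close>

text \<open>The inner product is linear in the first argument and conjugate-linear in the second.
  The last axiom makes it positive definite and says that it induces the given (complete) norm.\<close>

class complex_hilbert_space = banach +
  fixes scaleC :: "complex \<Rightarrow> 'a \<Rightarrow> 'a"  (infixr \<open>*\<^sub>C\<close> 75)
    and cinner :: "'a \<Rightarrow> 'a \<Rightarrow> complex"
  assumes scaleC_add_right: "c *\<^sub>C (x + y) = c *\<^sub>C x + c *\<^sub>C y"
    and scaleC_add_left: "(c + d) *\<^sub>C x = c *\<^sub>C x + d *\<^sub>C x"
    and scaleC_scaleC: "c *\<^sub>C d *\<^sub>C x = (c * d) *\<^sub>C x"
    and scaleC_of_real: "complex_of_real r *\<^sub>C x = r *\<^sub>R x"
    and cinner_commute: "cinner x y = cnj (cinner y x)"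
    and cinner_add_left: "cinner (x + y) z = cinner x z + cinner y z"
    and cinner_scaleC_left: "cinner (c *\<^sub>C x) y = c * cinner x y"
    and cinner_self: "cinner x x = complex_of_real ((norm x)\<^sup>2)"

text \<open>For a closed subspace \<open>S\<close>, the orthogonal projection onto \<open>S\<close>.\<close>

definition orth_proj :: "'h::complex_hilbert_space set \<Rightarrow> 'h \<Rightarrow> 'h" where
  "orth_proj S x = (THE p. p \<in> S \<and> (\<forall>s\<in>S. cinner (x - p) s = 0))"


section \<open>Radon measures\<close>

text \<open>The sigma-algebra may be larger than the Borel one, so that completions such as Lebesgue
  measure are covered.\<close>

definition radon_measure_on :: "'x topology \<Rightarrow> 'x measure \<Rightarrow> bool" where
  "radon_measure_on X \<mu> \<longleftrightarrow>
     space \<mu> = topspace X \<and>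
     (\<forall>U. openin X U \<longrightarrow> U \<in> sets \<mu>) \<and>
     (\<forall>K. compactin X K \<longrightarrow> emeasure \<mu> K < \<infinity>) \<and>
     (\<forall>A\<in>sets \<mu>. emeasure \<mu> A = (INF U\<in>{U. openin X U \<and> A \<subseteq> U}. emeasure \<mu> U)) \<and>
     (\<forall>U. openin X U \<longrightarrow> emeasure \<mu> U = (SUP K\<in>{K. compactin X K \<and> K \<subseteq> U}. emeasure \<mu> K))"


section \<open>Semi-frames\<close>

definition weakly_measurable :: "'x measure \<Rightarrow> ('x \<Rightarrow> 'h::complex_hilbert_space) \<Rightarrow> bool" where
  "weakly_measurable \<mu> \<phi> \<longleftrightarrow> (\<forall>f. (\<lambda>x. cinner f (\<phi> x)) \<in> borel_measurable \<mu>)"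

definition mu_total :: "'x measure \<Rightarrow> ('x \<Rightarrow> 'h::complex_hilbert_space) \<Rightarrow> bool" where
  "mu_total \<mu> \<phi> \<longleftrightarrow> weakly_measurable \<mu> \<phi> \<and>
     (\<forall>f. (AE x in \<mu>. cinner f (\<phi> x) = 0) \<longrightarrow> f = 0)"

definition bessel_mapping :: "'x measure \<Rightarrow> ('x \<Rightarrow> 'h::complex_hilbert_space) \<Rightarrow> bool" where
  "bessel_mapping \<mu> \<phi> \<longleftrightarrow> weakly_measurable \<mu> \<phi> \<and>
     (\<exists>M\<ge>0. \<forall>f. (\<integral>\<^sup>+x. ennreal ((cmod (cinner f (\<phi> x)))\<^sup>2) \<partial>\<mu>) \<le> ennreal (M * (norm f)\<^sup>2))"

definition upper_semi_frame :: "'x measure \<Rightarrow> ('x \<Rightarrow> 'h::complex_hilbert_space) \<Rightarrow> bool" where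
  "upper_semi_frame \<mu> \<phi> \<longleftrightarrow> mu_total \<mu> \<phi> \<and> bessel_mapping \<mu> \<phi>"

definition lower_semi_frame :: "'x measure \<Rightarrow> ('x \<Rightarrow> 'h::complex_hilbert_space) \<Rightarrow> bool" where
  "lower_semi_frame \<mu> \<phi> \<longleftrightarrow> weakly_measurable \<mu> \<phi> \<and>
     (\<exists>m>0. \<forall>f. ennreal (m * (norm f)\<^sup>2) \<le> (\<integral>\<^sup>+x. ennreal ((cmod (cinner f (\<phi> x)))\<^sup>2) \<partial>\<mu>))"


section \<open>Analysis operator and generalized frame operator\<close>

definition analysis_dom :: "'x measure \<Rightarrow> ('x \<Rightarrow> 'h::complex_hilbert_space) \<Rightarrow> 'h set" where
  "analysis_dom \<mu> \<phi> = {f. (\<integral>\<^sup>+x. ennreal ((cmod (cinner f (\<phi> x)))\<^sup>2) \<partial>\<mu>) < \<infinity>}"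

definition analysis_op :: "('x \<Rightarrow> 'h::complex_hilbert_space) \<Rightarrow> 'h \<Rightarrow> 'x \<Rightarrow> complex" where
  "analysis_op \<phi> f = (\<lambda>x. cinner f (\<phi> x))"

definition analysis_space :: "'x measure \<Rightarrow> ('x \<Rightarrow> 'h::complex_hilbert_space) \<Rightarrow> 'h set" where
  "analysis_space \<mu> \<phi> = closure (analysis_dom \<mu> \<phi>)"

definition frame_form :: "'x measure \<Rightarrow> ('x \<Rightarrow> 'h::complex_hilbert_space) \<Rightarrow> 'h \<Rightarrow> 'h \<Rightarrow> complex" where
  "frame_form \<mu> \<phi> f g = (\<integral>x. cinner f (\<phi> x) * cinner (\<phi> x) g \<partial>\<mu>)"

text \<open>Unbounded operators are represented by their graphs, so the inverse of an operator is the
  converse relation.\<close>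

definition op_apply :: "('a \<times> 'b) set \<Rightarrow> 'a \<Rightarrow> 'b" where
  "op_apply T x = (THE y. (x, y) \<in> T)"

text \<open>The operator that Kato's (first) representation theorem associates with a form \<open>\<Omega>\<close> with
  domain \<open>D\<close>, as an operator in the Hilbert space \<open>closure D\<close>: \<open>f\<close> is in its domain, with value
  \<open>h\<close>, iff \<open>\<Omega>(f,g) = \<langle>h|g\<rangle>\<close> for all \<open>g\<close> in \<open>D\<close>. For a closed non-negative form it is the unique
  self-adjoint operator \<open>T\<close> in \<open>closure D\<close> whose domain is contained in \<open>D\<close> and which satisfies
  \<open>\<Omega>(f,g) = \<langle>Tf|g\<rangle>\<close> for \<open>f\<close> in the domain of \<open>T\<close> and \<open>g\<close> in \<open>D\<close>.\<close>

definition form_operator ::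
  "'h::complex_hilbert_space set \<Rightarrow> ('h \<Rightarrow> 'h \<Rightarrow> complex) \<Rightarrow> ('h \<times> 'h) set" where
  "form_operator D \<Omega> = {(f, h). f \<in> D \<and> h \<in> closure D \<and> (\<forall>g\<in>D. \<Omega> f g = cinner h g)}"

definition gen_frame_op :: "'x measure \<Rightarrow> ('x \<Rightarrow> 'h::complex_hilbert_space) \<Rightarrow> ('h \<times> 'h) set" where
  "gen_frame_op \<mu> \<phi> = form_operator (analysis_dom \<mu> \<phi>) (frame_form \<mu> \<phi>)"

text \<open>The adjoint of the analysis operator, regarded as an operator from \<open>analysis_space \<mu> \<phi>\<close> to
  \<open>L\<^sup>2\<close>; elements of \<open>L\<^sup>2\<close> are given by representatives.\<close>

definition analysis_adjoint ::
  "'x measure \<Rightarrow> ('x \<Rightarrow> 'h::complex_hilbert_space) \<Rightarrow> (('x \<Rightarrow> complex) \<times> 'h) set" where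
  "analysis_adjoint \<mu> \<phi> =
     {(u, h). u \<in> borel_measurable \<mu> \<and> (\<integral>\<^sup>+x. ennreal ((cmod (u x))\<^sup>2) \<partial>\<mu>) < \<infinity> \<and>
        h \<in> analysis_space \<mu> \<phi> \<and>
        (\<forall>g\<in>analysis_dom \<mu> \<phi>. (\<integral>x. analysis_op \<phi> g x * cnj (u x) \<partial>\<mu>) = cinner g h)}"

lemma gen_frame_op_eq_adjoint_comp:
  assumes "weakly_measurable \<mu> \<phi>"
  shows "gen_frame_op \<mu> \<phi> =
    {(f, h). f \<in> analysis_dom \<mu> \<phi> \<and> (analysis_op \<phi> f, h) \<in> analysis_adjoint \<mu> \<phi>}"
proof -
  have "frame_form \<mu> \<phi> f g = cinner h g \<longleftrightarrow>
      (\<integral>x. analysis_op \<phi> g x * cnj (analysis_op \<phi> f x) \<partial>\<mu>) = cinner g h" for f g h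
  proof -
    have "cnj (frame_form \<mu> \<phi> f g) = (\<integral>x. cnj (cinner f (\<phi> x) * cinner (\<phi> x) g) \<partial>\<mu>)"
      unfolding frame_form_def by (rule Bochner_Integration.integral_cnj[symmetric])
    also have "\<dots> = (\<integral>x. analysis_op \<phi> g x * cnj (analysis_op \<phi> f x) \<partial>\<mu>)"
      by (simp add: analysis_op_def cinner_commute[of g] mult.commute)
    finally show ?thesis
      by (metis cinner_commute complex_cnj_cnj)
  qed
  then show ?thesis
    using assms
    by (auto simp: gen_frame_op_def form_operator_def analysis_adjoint_def analysis_space_def
        weakly_measurable_def analysis_op_def analysis_dom_def)
qed

text \<open>Duality in the weak sense; \<open>has_bochner_integral\<close> also asserts integrability.\<close>

definition dual_to :: "'x measure \<Rightarrow> ('x \<Rightarrow> 'h::complex_hilbert_space) \<Rightarrow> ('x \<Rightarrow> 'h) \<Rightarrow> bool" where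
  "dual_to \<mu> \<psi> \<phi> \<longleftrightarrow> (\<forall>f\<in>analysis_dom \<mu> \<phi>. \<forall>h.
     has_bochner_integral \<mu> (\<lambda>x. cinner f (\<phi> x) * cinner (\<psi> x) h) (cinner f h))"

end

theory Submission
  imports Defs
begin

text \<open>Write \<open>D\<close> for the domain of the analysis operator and \<open>\<Omega>\<close> for the frame form on it. The lower
  frame bound makes \<open>\<Omega>\<close> coercive and Fatou's lemma makes it closed, so every bounded functional
  \<open>\<langle>h|\<cdot>\<rangle>\<close> is represented on \<open>D\<close> by a unique vector \<open>A h \<in> D\<close>, that is
  \<open>\<Omega>(A h, g) = \<langle>h|g\<rangle>\<close> for \<open>g \<in> D\<close> (lemma \<open>closed_coercive_form_representation\<close>).
  The operator \<open>A\<close> is the inverse of the generalized frame operator composed with the projection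
  onto the closure of \<open>D\<close>, whence \<open>\<psi>\<^sub>x = A \<phi>\<^sub>x\<close> (lemma \<open>gen_frame_op_inverse\<close>).

  Since \<open>\<Omega>\<close> is Hermitian, \<open>\<langle>A h|k\<rangle> = \<Omega>(A h, A k) = \<langle>h|A k\<rangle>\<close>; in particular
  \<open>\<langle>f|\<psi>\<^sub>x\<rangle> = \<langle>A f|\<phi>\<^sub>x\<rangle>\<close>: the coefficients of \<open>f\<close> with respect to \<open>\<psi>\<close> are those of \<open>A f \<in> D\<close> with
  respect to \<open>\<phi>\<close>. All four claims can be read off this identity. Measurability is inherited from
  \<open>\<phi>\<close>. The Bessel integral of \<open>f\<close> is \<open>\<Omega>(A f, A f) = \<langle>f|A f\<rangle>\<close>, at most \<open>\<parallel>f\<parallel>\<^sup>2 / m\<close> for a lower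
  frame bound \<open>m\<close>. The duality integral is \<open>\<Omega>(f, A h) = \<langle>f|h\<rangle>\<close>. If the coefficients of \<open>f\<close> vanish
  almost everywhere then \<open>\<langle>f|g\<rangle> = \<Omega>(A f, g) = 0\<close> for all \<open>g \<in> D\<close>, so \<open>f = 0\<close> when \<open>D\<close> is dense.\<close>

section \<open>Complex inner products\<close>

lemma cinner_add_right: "cinner x (y + z) = cinner x y + cinner x z"
  by (metis cinner_add_left cinner_commute complex_cnj_add)

lemma cinner_scaleC_right: "cinner x (c *\<^sub>C y) = cnj c * cinner x y"
  by (metis cinner_commute cinner_scaleC_left complex_cnj_mult)

lemma cinner_scaleR_left: "cinner (r *\<^sub>R x) y = r *\<^sub>R cinner x y"
  by (metis cinner_scaleC_left scaleC_of_real scaleR_conv_of_real)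

lemma cinner_scaleR_right: "cinner x (r *\<^sub>R y) = r *\<^sub>R cinner x y"
  by (metis cinner_scaleC_right scaleC_of_real complex_cnj_complex_of_real scaleR_conv_of_real)

lemma norm_scaleC: "norm (c *\<^sub>C (x::'h::complex_hilbert_space)) = cmod c * norm x"
proof -
  have "complex_of_real ((norm (c *\<^sub>C x))\<^sup>2) = c * cnj c * complex_of_real ((norm x)\<^sup>2)"
    by (simp only: cinner_self[symmetric] cinner_scaleC_left cinner_scaleC_right mult.assoc mult.left_commute)
  also have "\<dots> = complex_of_real ((cmod c * norm x)\<^sup>2)"
    by (simp only: complex_norm_square[symmetric] power_mult_distrib of_real_mult)
  finally have "(norm (c *\<^sub>C x))\<^sup>2 = (cmod c * norm x)\<^sup>2"
    by (simp only: of_real_eq_iff)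
  then show ?thesis
    by (simp add: power2_eq_iff_nonneg)
qed

lemma norm_add_square:
  "(norm (x + y))\<^sup>2 = (norm x)\<^sup>2 + (norm y)\<^sup>2 + 2 * Re (cinner x (y::'h::complex_hilbert_space))"
proof -
  have "(norm (x + y))\<^sup>2 = Re (cinner (x + y) (x + y))"
    by (simp add: cinner_self)
  also have "\<dots> = Re (cinner x x) + Re (cinner y y) + (Re (cinner x y) + Re (cinner y x))"
    by (simp add: cinner_add_left cinner_add_right)
  also have "Re (cinner y x) = Re (cinner x y)"
    by (metis cinner_commute cnj.sel(1))
  finally show ?thesis
    by (simp add: cinner_self)
qed

text \<open>Expanding the square of the distance of \<open>x\<close> from its projection onto the line through \<open>y\<close>.\<close>

lemma norm_cinner_le: "cmod (cinner x y) \<le> norm x * norm (y::'h::complex_hilbert_space)"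
proof (cases "y = 0")
  case True
  have "cinner x (0 + 0) = cinner x 0 + cinner x 0"
    by (rule cinner_add_right)
  then show ?thesis using True by simp
next
  case False
  define c where "c = - (cinner x y / complex_of_real ((norm y)\<^sup>2))"
  have pos: "(norm y)\<^sup>2 > 0" using False by simp
  have "cinner x (c *\<^sub>C y) = - (complex_of_real ((cmod (cinner x y))\<^sup>2 / (norm y)\<^sup>2))"
    unfolding cinner_scaleC_right c_def
    by (simp add: mult.commute[of "cnj _"] flip: complex_norm_square)
  then have "Re (cinner x (c *\<^sub>C y)) = - ((cmod (cinner x y))\<^sup>2 / (norm y)\<^sup>2)"
    by (metis Re_complex_of_real uminus_complex.sel(1))
  moreover have "(norm (c *\<^sub>C y))\<^sup>2 = (cmod (cinner x y))\<^sup>2 / (norm y)\<^sup>2"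
  proof -
    have "cmod c = cmod (cinner x y) / (norm y)\<^sup>2"
      by (simp add: c_def norm_divide norm_power)
    then show ?thesis
      using False by (simp add: norm_scaleC power2_eq_square)
  qed
  ultimately have "0 \<le> (norm x)\<^sup>2 - (cmod (cinner x y))\<^sup>2 / (norm y)\<^sup>2"
    using norm_add_square[of x "c *\<^sub>C y"] zero_le_power2[of "norm (x + c *\<^sub>C y)"] by linarith
  then have "(cmod (cinner x y))\<^sup>2 \<le> (norm x * norm y)\<^sup>2"
    using pos by (simp add: divide_simps power_mult_distrib)
  then show ?thesis
    by (rule power2_le_imp_le) simp
qed

lemma bounded_bilinear_cinner: "bounded_bilinear cinner"
  by (rule bounded_bilinear.intro)
    (auto simp: cinner_add_left cinner_add_right cinner_scaleR_left cinner_scaleR_right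
      norm_cinner_le intro: exI[of _ 1])

lemmas cinner_simps =
  bounded_bilinear.zero_left[OF bounded_bilinear_cinner]
  bounded_bilinear.zero_right[OF bounded_bilinear_cinner]
  bounded_bilinear.diff_left[OF bounded_bilinear_cinner]

lemmas tendsto_cinner = bounded_bilinear.tendsto[OF bounded_bilinear_cinner]

lemma cinner_self_eq_0_iff: "cinner x x = 0 \<longleftrightarrow> x = (0::'h::complex_hilbert_space)"
  by (simp add: cinner_self)

lemma eq_0_if_orthogonal_to_dense:
  fixes k :: "'h::complex_hilbert_space"
  assumes "k \<in> closure D" and "\<And>g. g \<in> D \<Longrightarrow> cinner k g = 0"
  shows "k = 0"
proof -
  obtain s where "\<And>n. s n \<in> D" and lim: "s \<longlonglongrightarrow> k"
    using assms(1) by (auto simp: closure_sequential)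
  then have "cinner k (s n) = 0" for n using assms(2) by simp
  moreover have "(\<lambda>n. cinner k (s n)) \<longlonglongrightarrow> cinner k k"
    by (intro tendsto_cinner tendsto_const lim)
  ultimately have "cinner k k = 0"
    by (simp add: LIMSEQ_const_iff)
  then show ?thesis by (simp add: cinner_self_eq_0_iff)
qed

definition complex_subspace :: "'h::complex_hilbert_space set \<Rightarrow> bool" where
  "complex_subspace D \<longleftrightarrow> 0 \<in> D \<and> (\<forall>x\<in>D. \<forall>y\<in>D. x + y \<in> D) \<and> (\<forall>c. \<forall>x\<in>D. c *\<^sub>C x \<in> D)"

lemma complex_subspace_minus:
  assumes "complex_subspace D" "x \<in> D" "y \<in> D"
  shows "x - y \<in> D"
proof -
  have "x + (complex_of_real (-1)) *\<^sub>C y \<in> D"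
    using assms by (auto simp: complex_subspace_def)
  then show ?thesis by (simp only: scaleC_of_real) simp
qed

lemma complex_subspace_closure:
  assumes "complex_subspace D"
  shows "complex_subspace (closure D)"
  unfolding complex_subspace_def
proof (intro conjI ballI allI)
  show "0 \<in> closure D"
    using assms closure_subset by (auto simp: complex_subspace_def)
next
  fix x y assume "x \<in> closure D" "y \<in> closure D"
  then obtain s t where "\<And>n. s n \<in> D" "s \<longlonglongrightarrow> x" "\<And>n. t n \<in> D" "t \<longlonglongrightarrow> y"
    by (auto simp: closure_sequential)
  then have "\<forall>n. s n + t n \<in> D" "(\<lambda>n. s n + t n) \<longlonglongrightarrow> x + y"
    using assms by (auto simp: complex_subspace_def intro: tendsto_add)
  then show "x + y \<in> closure D"
    unfolding closure_sequential by (intro exI[of _ "\<lambda>n. s n + t n"] conjI)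
next
  fix c x assume "x \<in> closure D"
  then obtain s where s: "\<And>n. s n \<in> D" "s \<longlonglongrightarrow> x"
    by (auto simp: closure_sequential)
  have lin: "bounded_linear (\<lambda>y::'a. c *\<^sub>C y)"
    by (rule bounded_linear_intro[where K = "cmod c"])
      (simp_all add: scaleC_add_right scaleC_scaleC norm_scaleC mult.commute
        flip: scaleC_of_real)
  have "\<forall>n. c *\<^sub>C s n \<in> D"
    using assms s by (auto simp: complex_subspace_def)
  moreover have "(\<lambda>n. c *\<^sub>C s n) \<longlonglongrightarrow> c *\<^sub>C x"
    by (rule bounded_linear.tendsto[OF lin s(2)])
  ultimately show "c *\<^sub>C x \<in> closure D"
    unfolding closure_sequential by (intro exI[of _ "\<lambda>n. c *\<^sub>C s n"] conjI)
qed

section \<open>Closed coercive forms\<close>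

lemma quadratic_nonneg_imp_linear_part_0:
  fixes a b :: real
  assumes "b \<ge> 0" and nonneg: "\<And>t. 0 \<le> 2 * t * a + t\<^sup>2 * b"
  shows "a = 0"
proof (rule ccontr)
  assume "a \<noteq> 0"
  \<comment> \<open>the minimum of the quadratic would be at \<open>-a/b\<close>; adding 1 avoids the case \<open>b = 0\<close>\<close>
  have "2 * (- a / (b + 1)) * a + (- a / (b + 1))\<^sup>2 * b = - (a\<^sup>2 * (b + 2)) / (b + 1)\<^sup>2"
    using assms(1) by (simp add: divide_simps power2_eq_square) (simp add: algebra_simps)
  moreover have "a\<^sup>2 * (b + 2) / (b + 1)\<^sup>2 > 0"
    using \<open>a \<noteq> 0\<close> assms(1) by simp
  ultimately show False
    using nonneg[of "- a / (b + 1)"] by simp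
qed

text \<open>The representing vector is the minimizer of the energy \<open>J(f) = B(f,f) - 2 Re \<langle>f|h\<rangle>\<close>.
  Coercivity bounds \<open>J\<close> from below and, through the parallelogram law, makes every minimizing
  sequence Cauchy in norm. The assumption \<open>lsc\<close> is the form in which closedness is needed here:
  lower semicontinuity of \<open>B(f,f)\<close> along sequences that converge in norm, so that the limit lies in
  \<open>D\<close> and attains the infimum. The variational equation of \<open>J\<close> at the minimizer is the claim.\<close>

lemma closed_coercive_form_representation:
  fixes D :: "'h::complex_hilbert_space set" and B :: "'h \<Rightarrow> 'h \<Rightarrow> complex"
  assumes D: "complex_subspace D"
    and add: "\<And>f g k. f \<in> D \<Longrightarrow> g \<in> D \<Longrightarrow> k \<in> D \<Longrightarrow> B (f + g) k = B f k + B g k"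
    and scale: "\<And>c f g. f \<in> D \<Longrightarrow> g \<in> D \<Longrightarrow> B (c *\<^sub>C f) g = c * B f g"
    and herm: "\<And>f g. f \<in> D \<Longrightarrow> g \<in> D \<Longrightarrow> B g f = cnj (B f g)"
    and "m > 0" and coercive: "\<And>f. f \<in> D \<Longrightarrow> m * (norm f)\<^sup>2 \<le> Re (B f f)"
    and lsc: "\<And>s f L. (\<And>n. s n \<in> D) \<Longrightarrow> s \<longlonglongrightarrow> f \<Longrightarrow> (\<lambda>n. Re (B (s n) (s n))) \<longlonglongrightarrow> L
                 \<Longrightarrow> f \<in> D \<and> Re (B f f) \<le> L"
  shows "\<exists>f\<in>D. \<forall>g\<in>D. B f g = cinner h g"
proof -
  define J where "J f = Re (B f f) - 2 * Re (cinner f h)" for f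
  have inD: "f + g \<in> D" "c *\<^sub>C f \<in> D" if "f \<in> D" "g \<in> D" for f g c
    using D that by (auto simp: complex_subspace_def)
  have scaleR_D: "r *\<^sub>R f \<in> D" if "f \<in> D" for r f
    using inD(2)[OF that that, of "complex_of_real r"] by (simp add: scaleC_of_real)
  have B_add: "Re (B (f + g) (f + g)) = Re (B f f) + Re (B g g) + 2 * Re (B f g)"
    if "f \<in> D" "g \<in> D" for f g
  proof -
    have "B f (f + g) = cnj (B (f + g) f)" "B g (f + g) = cnj (B (f + g) g)"
      using that inD by (auto intro: herm)
    then show ?thesis
      using that inD herm[OF that] by (simp add: add)
  qed
  have B_scaleR: "Re (B (r *\<^sub>R f) (r *\<^sub>R f)) = r\<^sup>2 * Re (B f f)" "Re (B (r *\<^sub>R f) g) = r * Re (B f g)"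
    "Re (B f (r *\<^sub>R g)) = r * Re (B f g)"
    if "f \<in> D" "g \<in> D" for r f g
  proof -
    have left: "B (r *\<^sub>R f) g = complex_of_real r * B f g" if "f \<in> D" "g \<in> D" for f g
      using scale[OF that, of "complex_of_real r"] by (simp add: scaleC_of_real)
    have right: "B f (r *\<^sub>R g) = complex_of_real r * B f g" if "f \<in> D" "g \<in> D" for f g
      using herm[of "r *\<^sub>R g" f] herm[of g f] that left[of g f] scaleR_D by simp
    show "Re (B (r *\<^sub>R f) (r *\<^sub>R f)) = r\<^sup>2 * Re (B f f)"
      "Re (B (r *\<^sub>R f) g) = r * Re (B f g)" "Re (B f (r *\<^sub>R g)) = r * Re (B f g)"
      using that scaleR_D by (simp_all add: left right power2_eq_square mult.assoc)
  qed
  have below: "- ((norm h)\<^sup>2 / m) \<le> J f" if "f \<in> D" for f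
  proof -
    have "Re (cinner f h) \<le> norm f * norm h"
      using complex_Re_le_cmod norm_cinner_le order_trans by blast
    moreover have "0 \<le> m * (norm f - norm h / m)\<^sup>2"
      using \<open>m > 0\<close> by simp
    moreover have "m * (norm f - norm h / m)\<^sup>2
        = m * (norm f)\<^sup>2 - 2 * (norm f * norm h) + (norm h)\<^sup>2 / m"
      using \<open>m > 0\<close> by (simp add: power2_eq_square field_simps)
    ultimately show ?thesis
      using coercive[OF that] unfolding J_def by linarith
  qed
  define I where "I = Inf (J ` D)"
  have "D \<noteq> {}" using D by (auto simp: complex_subspace_def)
  have bdd: "bdd_below (J ` D)"
    using below by (auto intro!: bdd_belowI)
  have I_le: "I \<le> J f" if "f \<in> D" for f
    unfolding I_def using bdd that by (auto intro: cInf_lower)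
  have "\<exists>f\<in>D. J f < I + inverse (real (Suc n))" for n
    using cInf_lessD[of "J ` D" "I + inverse (real (Suc n))"] \<open>D \<noteq> {}\<close> by (auto simp: I_def)
  then obtain s where s: "\<And>n. s n \<in> D" "\<And>n. J (s n) < I + inverse (real (Suc n))"
    by metis
  have parallelogram: "m * (norm (f - g))\<^sup>2 \<le> 2 * J f + 2 * J g - 4 * I"
    if fg: "f \<in> D" "g \<in> D" for f g
  proof -
    have minus: "(- 1) *\<^sub>R g \<in> D" using fg scaleR_D by blast
    have "Re (B (f - g) (f - g)) = Re (B f f) + Re (B g g) - 2 * Re (B f g)"
      using B_add[OF fg(1) minus] B_scaleR(1)[of g g "- 1"] B_scaleR(3)[of f g "- 1"] fg by simp
    moreover have "4 * J ((1/2) *\<^sub>R (f + g))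
        = Re (B f f) + Re (B g g) + 2 * Re (B f g) - 4 * Re (cinner f h) - 4 * Re (cinner g h)"
      unfolding J_def B_scaleR(1)[OF inD(1)[OF fg] fg(1)] B_add[OF fg]
      by (simp add: cinner_scaleR_left cinner_add_left power2_eq_square add_divide_distrib)
    moreover have "4 * I \<le> 4 * J ((1/2) *\<^sub>R (f + g))"
      using fg inD(1) scaleR_D I_le by simp
    moreover have "m * (norm (f - g))\<^sup>2 \<le> Re (B (f - g) (f - g))"
      using coercive complex_subspace_minus[OF D fg] .
    ultimately have "m * (norm (f - g))\<^sup>2
        \<le> 2 * Re (B f f) + 2 * Re (B g g) - 4 * Re (cinner f h) - 4 * Re (cinner g h) - 4 * I"
      by linarith
    then show ?thesis
      by (simp add: J_def)
  qed
  have "Cauchy s"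
  proof (rule CauchyI)
    fix e :: real assume "e > 0"
    then obtain N where N: "inverse (real (Suc N)) < m * e\<^sup>2 / 4"
      using reals_Archimedean[of "m * e\<^sup>2 / 4"] \<open>m > 0\<close> by auto
    have close: "norm (s i - s j) < e" if "i \<ge> N" "j \<ge> N" for i j
    proof -
      have small: "J (s k) < I + m * e\<^sup>2 / 4" if "k \<ge> N" for k
      proof -
        have "inverse (real (Suc k)) \<le> inverse (real (Suc N))"
          using that by (simp add: divide_simps)
        then show ?thesis using s(2)[of k] N by linarith
      qed
      have "m * (norm (s i - s j))\<^sup>2 < m * e\<^sup>2"
        using parallelogram[OF s(1) s(1), of i j] small[OF that(1)] small[OF that(2)] by linarith
      then have "(norm (s i - s j))\<^sup>2 < e\<^sup>2" using \<open>m > 0\<close> by simp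
      then show ?thesis using \<open>e > 0\<close> by (simp add: power_less_imp_less_base)
    qed
    then show "\<exists>M. \<forall>i\<ge>M. \<forall>j\<ge>M. norm (s i - s j) < e" by blast
  qed
  then obtain f where lim: "s \<longlonglongrightarrow> f"
    using Cauchy_convergent convergent_def by blast
  have "(\<lambda>n. I + inverse (real (Suc n))) \<longlonglongrightarrow> I"
    using tendsto_add[OF tendsto_const LIMSEQ_inverse_real_of_nat] by simp
  then have "(\<lambda>n. J (s n)) \<longlonglongrightarrow> I"
    by (rule tendsto_sandwich[OF _ _ tendsto_const, rotated -1])
      (use s I_le in \<open>auto intro!: always_eventually less_imp_le\<close>)
  moreover have "(\<lambda>n. Re (cinner (s n) h)) \<longlonglongrightarrow> Re (cinner f h)"
    by (intro tendsto_intros tendsto_cinner lim)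
  ultimately have "(\<lambda>n. J (s n) + 2 * Re (cinner (s n) h)) \<longlonglongrightarrow> I + 2 * Re (cinner f h)"
    by (intro tendsto_add tendsto_mult tendsto_const)
  then have "(\<lambda>n. Re (B (s n) (s n))) \<longlonglongrightarrow> I + 2 * Re (cinner f h)"
    by (simp add: J_def)
  from lsc[OF s(1) lim this] have f: "f \<in> D" "J f \<le> I"
    by (auto simp: J_def)
  have real_part: "Re (B f g) = Re (cinner h g)" if "g \<in> D" for g
  proof -
    have "0 \<le> 2 * t * (Re (B f g) - Re (cinner g h)) + t\<^sup>2 * Re (B g g)" for t
    proof -
      have "J f \<le> J (f + t *\<^sub>R g)"
        using f that I_le inD(1) scaleR_D by (meson order_trans)
      moreover have "J (f + t *\<^sub>R g)
          = J f + (2 * t * (Re (B f g) - Re (cinner g h)) + t\<^sup>2 * Re (B g g))"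
        unfolding J_def using f that scaleR_D
        by (simp add: B_add B_scaleR cinner_add_left cinner_scaleR_left power2_eq_square algebra_simps)
      ultimately show ?thesis by linarith
    qed
    moreover have "0 \<le> Re (B g g)"
      using coercive[OF that] \<open>m > 0\<close> by (meson mult_nonneg_nonneg less_imp_le order_trans zero_le_power2)
    ultimately have "Re (B f g) - Re (cinner g h) = 0"
      by (rule quadratic_nonneg_imp_linear_part_0[rotated])
    then show ?thesis
      using cinner_commute[of g h] by simp
  qed
  have "B f g = cinner h g" if "g \<in> D" for g
  proof (rule complex_eqI)
    show "Re (B f g) = Re (cinner h g)" using real_part[OF that] .
    \<comment> \<open>both sides are conjugate-linear in \<open>g\<close>, and \<open>Re (-\<i> z) = Im z\<close>\<close>
    have ig: "\<i> *\<^sub>C g \<in> D" using inD(2)[OF that that] .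
    have "B f (\<i> *\<^sub>C g) = - \<i> * B f g"
      using herm[OF ig f(1)] scale[OF that f(1), of \<i>] herm[OF that f(1)] by simp
    then show "Im (B f g) = Im (cinner h g)"
      using real_part[OF ig] by (simp add: cinner_scaleC_right)
  qed
  with f(1) show ?thesis by blast
qed

text \<open>The inner product itself is a closed coercive form on a closed subspace, so the
  representation theorem yields the orthogonal projection.\<close>

lemma orth_proj:
  fixes S :: "'h::complex_hilbert_space set"
  assumes "complex_subspace S" "closed S"
  shows "orth_proj S x \<in> S" and "\<And>s. s \<in> S \<Longrightarrow> cinner (orth_proj S x) s = cinner x s"
proof -
  have "\<exists>p\<in>S. \<forall>s\<in>S. cinner p s = cinner x s"
  proof (rule closed_coercive_form_representation[where m = 1])
    fix s f and L :: real
    assume s: "\<And>n. s n \<in> S" "s \<longlonglongrightarrow> f" "(\<lambda>n. Re (cinner (s n) (s n))) \<longlonglongrightarrow> L"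
    have "(\<lambda>n. Re (cinner (s n) (s n))) \<longlonglongrightarrow> Re (cinner f f)"
      by (intro tendsto_intros tendsto_cinner s)
    then have "Re (cinner f f) = L" using s(3) by (rule LIMSEQ_unique)
    moreover have "f \<in> S" using closed_sequentially[OF assms(2) _ s(2)] s(1) by simp
    ultimately show "f \<in> S \<and> Re (cinner f f) \<le> L" by simp
  qed (use assms in \<open>simp_all add: cinner_add_left cinner_scaleC_left cinner_self
         flip: cinner_commute\<close>)
  then obtain p where p: "p \<in> S" "\<forall>s\<in>S. cinner (x - p) s = 0"
    unfolding cinner_simps right_minus_eq by metis
  have "q = p" if q: "q \<in> S" "\<forall>s\<in>S. cinner (x - q) s = 0" for q
  proof -
    have "q - p \<in> S" using complex_subspace_minus[OF assms(1) q(1) p(1)] .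
    then have "cinner (x - p) (q - p) = 0" "cinner (x - q) (q - p) = 0" using p q by auto
    then have "cinner (q - p) (q - p) = 0" by (simp add: cinner_simps)
    then show ?thesis by (simp add: cinner_self_eq_0_iff)
  qed
  then have "orth_proj S x = p"
    unfolding orth_proj_def using p by (intro the_equality) blast+
  then show "orth_proj S x \<in> S" and "\<And>s. s \<in> S \<Longrightarrow> cinner (orth_proj S x) s = cinner x s"
    using p by (simp_all add: cinner_simps)
qed

section \<open>The frame form\<close>

lemma analysis_dom_iff_square_integrable:
  assumes "weakly_measurable \<mu> \<phi>"
  shows "f \<in> analysis_dom \<mu> \<phi> \<longleftrightarrow> integrable \<mu> (\<lambda>x. (cmod (cinner f (\<phi> x)))\<^sup>2)"
proof -
  have [measurable]: "(\<lambda>x. cinner f (\<phi> x)) \<in> borel_measurable \<mu>"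
    using assms by (simp add: weakly_measurable_def)
  show ?thesis
    by (simp add: analysis_dom_def integrable_iff_bounded)
qed

lemma complex_subspace_analysis_dom:
  assumes "weakly_measurable \<mu> \<phi>"
  shows "complex_subspace (analysis_dom \<mu> \<phi>)"
proof -
  have meas: "(\<lambda>x. cinner f (\<phi> x)) \<in> borel_measurable \<mu>" for f
    using assms by (simp add: weakly_measurable_def)
  have "integrable \<mu> (\<lambda>x. (cmod (cinner (f + g) (\<phi> x)))\<^sup>2)"
    if "integrable \<mu> (\<lambda>x. (cmod (cinner f (\<phi> x)))\<^sup>2)" "integrable \<mu> (\<lambda>x. (cmod (cinner g (\<phi> x)))\<^sup>2)"
    for f g
  proof (rule Bochner_Integration.integrable_bound)
    show "integrable \<mu> (\<lambda>x. 2 * (cmod (cinner f (\<phi> x)))\<^sup>2 + 2 * (cmod (cinner g (\<phi> x)))\<^sup>2)"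
      using that by simp
    have "(cmod (a + b))\<^sup>2 \<le> 2 * (cmod a)\<^sup>2 + 2 * (cmod b)\<^sup>2" for a b :: complex
    proof -
      have "(cmod (a + b))\<^sup>2 \<le> (cmod a + cmod b)\<^sup>2"
        by (simp add: norm_triangle_ineq)
      also have "\<dots> \<le> 2 * (cmod a)\<^sup>2 + 2 * (cmod b)\<^sup>2"
        using sum_squares_bound[of "cmod a" "cmod b"] by (simp add: power2_sum)
      finally show ?thesis .
    qed
    then show "AE x in \<mu>. norm ((cmod (cinner (f + g) (\<phi> x)))\<^sup>2)
        \<le> norm (2 * (cmod (cinner f (\<phi> x)))\<^sup>2 + 2 * (cmod (cinner g (\<phi> x)))\<^sup>2)"
      by (auto simp: cinner_add_left)
  qed (use meas in measurable)
  then show ?thesis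
    unfolding complex_subspace_def
    by (auto simp: analysis_dom_iff_square_integrable[OF assms] cinner_simps cinner_scaleC_left norm_mult power_mult_distrib)
qed

lemma frame_form_integrable:
  assumes "weakly_measurable \<mu> \<phi>" "f \<in> analysis_dom \<mu> \<phi>" "g \<in> analysis_dom \<mu> \<phi>"
  shows "integrable \<mu> (\<lambda>x. cinner f (\<phi> x) * cinner (\<phi> x) g)"
proof (rule Bochner_Integration.integrable_bound)
  have meas[measurable]: "(\<lambda>x. cinner f (\<phi> x)) \<in> borel_measurable \<mu>" for f
    using assms(1) by (simp add: weakly_measurable_def)
  show "integrable \<mu> (\<lambda>x. (cmod (cinner f (\<phi> x)))\<^sup>2 + (cmod (cinner g (\<phi> x)))\<^sup>2)"
    using assms by (auto simp: analysis_dom_iff_square_integrable)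
  have "(\<lambda>x. cinner f (\<phi> x) * cnj (cinner g (\<phi> x))) \<in> borel_measurable \<mu>"
    by (intro borel_measurable_times meas borel_measurable_continuous_on[OF _ meas]
        continuous_intros)
  then show "(\<lambda>x. cinner f (\<phi> x) * cinner (\<phi> x) g) \<in> borel_measurable \<mu>"
    by (simp flip: cinner_commute)
  have "cmod a * cmod b \<le> (cmod a)\<^sup>2 + (cmod b)\<^sup>2" for a b :: complex
  proof -
    have "0 \<le> cmod a * cmod b" by simp
    then show ?thesis using sum_squares_bound[of "cmod a" "cmod b"] by linarith
  qed
  moreover have "cmod (cinner (\<phi> x) g) = cmod (cinner g (\<phi> x))" for x
    unfolding cinner_commute[of "\<phi> x" g] by simp
  ultimately show "AE x in \<mu>. norm (cinner f (\<phi> x) * cinner (\<phi> x) g)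
      \<le> norm ((cmod (cinner f (\<phi> x)))\<^sup>2 + (cmod (cinner g (\<phi> x)))\<^sup>2)"
    by (simp add: norm_mult)
qed

lemma frame_form_add_left:
  assumes "weakly_measurable \<mu> \<phi>"
    and "f \<in> analysis_dom \<mu> \<phi>" "g \<in> analysis_dom \<mu> \<phi>" "k \<in> analysis_dom \<mu> \<phi>"
  shows "frame_form \<mu> \<phi> (f + g) k = frame_form \<mu> \<phi> f k + frame_form \<mu> \<phi> g k"
  unfolding frame_form_def cinner_add_left distrib_right
  using assms by (intro Bochner_Integration.integral_add frame_form_integrable)

lemma frame_form_scaleC_left: "frame_form \<mu> \<phi> (c *\<^sub>C f) g = c * frame_form \<mu> \<phi> f g"
  by (simp add: frame_form_def cinner_scaleC_left mult.assoc)

lemma frame_form_commute: "frame_form \<mu> \<phi> g f = cnj (frame_form \<mu> \<phi> f g)"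
proof -
  have "cnj (frame_form \<mu> \<phi> f g) = (\<integral>x. cnj (cinner f (\<phi> x) * cinner (\<phi> x) g) \<partial>\<mu>)"
    unfolding frame_form_def by (rule Bochner_Integration.integral_cnj[symmetric])
  also have "\<dots> = frame_form \<mu> \<phi> g f"
    by (simp add: frame_form_def mult.commute flip: cinner_commute)
  finally show ?thesis by simp
qed

lemma nn_integral_eq_frame_form:
  assumes "weakly_measurable \<mu> \<phi>" "f \<in> analysis_dom \<mu> \<phi>"
  shows "(\<integral>\<^sup>+x. ennreal ((cmod (cinner f (\<phi> x)))\<^sup>2) \<partial>\<mu>) = ennreal (Re (frame_form \<mu> \<phi> f f))"
    and "Re (frame_form \<mu> \<phi> f f) \<ge> 0"
proof -
  have "cinner f (\<phi> x) * cinner (\<phi> x) f = complex_of_real ((cmod (cinner f (\<phi> x)))\<^sup>2)" for x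
    unfolding complex_norm_square cinner_commute[of "\<phi> x" f] ..
  then have eq: "Re (frame_form \<mu> \<phi> f f) = (\<integral>x. (cmod (cinner f (\<phi> x)))\<^sup>2 \<partial>\<mu>)"
    unfolding frame_form_def by (simp only: integral_complex_of_real Re_complex_of_real)
  show "(\<integral>\<^sup>+x. ennreal ((cmod (cinner f (\<phi> x)))\<^sup>2) \<partial>\<mu>) = ennreal (Re (frame_form \<mu> \<phi> f f))"
    unfolding eq using assms
    by (intro nn_integral_eq_integral) (auto simp: analysis_dom_iff_square_integrable)
  show "Re (frame_form \<mu> \<phi> f f) \<ge> 0"
    unfolding eq by simp
qed

text \<open>Norm convergence of the vectors gives pointwise convergence of their coefficients, so Fatou's
  lemma applies; this replaces an argument by completeness of \<open>L\<^sup>2\<close>.\<close>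

lemma frame_form_lower_semicontinuous:
  assumes wm: "weakly_measurable \<mu> \<phi>"
    and s: "\<And>n. s n \<in> analysis_dom \<mu> \<phi>" "s \<longlonglongrightarrow> f"
    and L: "(\<lambda>n. Re (frame_form \<mu> \<phi> (s n) (s n))) \<longlonglongrightarrow> L"
  shows "f \<in> analysis_dom \<mu> \<phi> \<and> Re (frame_form \<mu> \<phi> f f) \<le> L"
proof -
  have meas[measurable]: "(\<lambda>x. cinner f (\<phi> x)) \<in> borel_measurable \<mu>" for f
    using wm by (simp add: weakly_measurable_def)
  have "L \<ge> 0"
    using LIMSEQ_le_const[OF L] nn_integral_eq_frame_form(2)[OF wm s(1)] by blast
  have ptw: "liminf (\<lambda>n. ennreal ((cmod (cinner (s n) (\<phi> x)))\<^sup>2)) = ennreal ((cmod (cinner f (\<phi> x)))\<^sup>2)"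
    for x
    by (intro lim_imp_Liminf tendsto_ennrealI tendsto_intros tendsto_cinner s) simp
  have "(\<integral>\<^sup>+x. ennreal ((cmod (cinner f (\<phi> x)))\<^sup>2) \<partial>\<mu>)
      = (\<integral>\<^sup>+x. liminf (\<lambda>n. ennreal ((cmod (cinner (s n) (\<phi> x)))\<^sup>2)) \<partial>\<mu>)"
    by (simp add: ptw)
  also have "\<dots> \<le> liminf (\<lambda>n. \<integral>\<^sup>+x. ennreal ((cmod (cinner (s n) (\<phi> x)))\<^sup>2) \<partial>\<mu>)"
    by (rule nn_integral_liminf) measurable
  also have "\<dots> = liminf (\<lambda>n. ennreal (Re (frame_form \<mu> \<phi> (s n) (s n))))"
    by (simp add: nn_integral_eq_frame_form(1)[OF wm s(1)])
  also have "\<dots> = ennreal L"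
    by (intro lim_imp_Liminf tendsto_ennrealI L) simp
  finally have le: "(\<integral>\<^sup>+x. ennreal ((cmod (cinner f (\<phi> x)))\<^sup>2) \<partial>\<mu>) \<le> ennreal L" .
  then have "f \<in> analysis_dom \<mu> \<phi>"
    by (auto simp: analysis_dom_def intro: le_less_trans)
  with le \<open>L \<ge> 0\<close> show ?thesis
    by (simp add: nn_integral_eq_frame_form(1)[OF wm])
qed

lemma lower_semi_frame_coercive:
  assumes "lower_semi_frame \<mu> \<phi>"
  obtains m where "m > 0"
    and "\<And>f. f \<in> analysis_dom \<mu> \<phi> \<Longrightarrow> m * (norm f)\<^sup>2 \<le> Re (frame_form \<mu> \<phi> f f)"
proof -
  have wm: "weakly_measurable \<mu> \<phi>" using assms(1) by (simp add: lower_semi_frame_def)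
  obtain m where "m > 0" and le: "\<And>f. ennreal (m * (norm f)\<^sup>2)
      \<le> (\<integral>\<^sup>+x. ennreal ((cmod (cinner f (\<phi> x)))\<^sup>2) \<partial>\<mu>)"
    using assms unfolding lower_semi_frame_def by blast
  moreover have "m * (norm f)\<^sup>2 \<le> Re (frame_form \<mu> \<phi> f f)" if "f \<in> analysis_dom \<mu> \<phi>" for f
    using le[of f] nn_integral_eq_frame_form[OF wm that] by (simp add: ennreal_le_iff)
  ultimately show ?thesis using that by blast
qed

section \<open>The inverse of the generalized frame operator\<close>

lemma frame_form_representation:
  assumes "lower_semi_frame \<mu> \<phi>"
  shows "\<exists>f\<in>analysis_dom \<mu> \<phi>. \<forall>g\<in>analysis_dom \<mu> \<phi>. frame_form \<mu> \<phi> f g = cinner h g"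
proof -
  have wm: "weakly_measurable \<mu> \<phi>" using assms(1) by (simp add: lower_semi_frame_def)
  obtain m where m: "m > 0"
    "\<And>f. f \<in> analysis_dom \<mu> \<phi> \<Longrightarrow> m * (norm f)\<^sup>2 \<le> Re (frame_form \<mu> \<phi> f f)"
    using lower_semi_frame_coercive[OF assms] by blast
  show ?thesis
    by (rule closed_coercive_form_representation[OF complex_subspace_analysis_dom[OF wm]
          frame_form_add_left[OF wm] frame_form_scaleC_left frame_form_commute m
          frame_form_lower_semicontinuous[OF wm]])
qed

text \<open>The vector that represents \<open>\<langle>h|\<cdot>\<rangle>\<close> on the form domain is obtained by projecting \<open>h\<close> onto
  the closure of the domain, which does not change the functional there, and then inverting the
  operator. Coercivity makes the representing vector unique, so that the inverse is single-valued.\<close>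

lemma gen_frame_op_inverse:
  assumes "lower_semi_frame \<mu> \<phi>"
    and f: "f \<in> analysis_dom \<mu> \<phi>" "\<And>g. g \<in> analysis_dom \<mu> \<phi> \<Longrightarrow> frame_form \<mu> \<phi> f g = cinner h g"
  shows "op_apply ((gen_frame_op \<mu> \<phi>)\<inverse>) (orth_proj (analysis_space \<mu> \<phi>) h) = f"
proof -
  let ?D = "analysis_dom \<mu> \<phi>"
  have wm: "weakly_measurable \<mu> \<phi>" using assms(1) by (simp add: lower_semi_frame_def)
  obtain m where m: "m > 0" "\<And>f. f \<in> ?D \<Longrightarrow> m * (norm f)\<^sup>2 \<le> Re (frame_form \<mu> \<phi> f f)"
    using lower_semi_frame_coercive[OF assms(1)] by blast
  have sub: "complex_subspace ?D" using complex_subspace_analysis_dom[OF wm] .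
  define p where "p = orth_proj (closure ?D) h"
  have p: "p \<in> closure ?D" "\<And>g. g \<in> ?D \<Longrightarrow> cinner p g = cinner h g"
    unfolding p_def using closure_subset[of ?D]
    by (auto intro!: orth_proj[OF complex_subspace_closure[OF sub] closed_closure])
  have unique: "f' = f" if f': "f' \<in> ?D" "\<And>g. g \<in> ?D \<Longrightarrow> frame_form \<mu> \<phi> f' g = cinner p g" for f'
  proof -
    have d: "f' - f \<in> ?D" using complex_subspace_minus[OF sub f'(1) f(1)] .
    have "frame_form \<mu> \<phi> f' (f' - f) = frame_form \<mu> \<phi> f (f' - f)"
      using f'(2)[OF d] f(2)[OF d] p(2)[OF d] by simp
    then have "frame_form \<mu> \<phi> (f' - f) (f' - f) = 0"
      using frame_form_add_left[OF wm d f(1) d] by simp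
    then have "m * (norm (f' - f))\<^sup>2 \<le> 0" using m(2)[OF d] by simp
    then show ?thesis using m(1) by (simp add: mult_le_0_iff)
  qed
  have "(p, k) \<in> (gen_frame_op \<mu> \<phi>)\<inverse> \<longleftrightarrow> k \<in> ?D \<and> (\<forall>g\<in>?D. frame_form \<mu> \<phi> k g = cinner p g)" for k
    using p(1) by (simp add: gen_frame_op_def form_operator_def)
  moreover have "\<forall>g\<in>?D. frame_form \<mu> \<phi> f g = cinner p g"
    using f(2) p(2) by simp
  ultimately have "op_apply ((gen_frame_op \<mu> \<phi>)\<inverse>) p = f"
    unfolding op_apply_def using f(1) unique by (intro the_equality) blast+
  then show ?thesis by (simp add: p_def analysis_space_def)
qed

section \<open>The canonical dual of a lower semi-frame\<close>

theorem proposition3p2: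
  fixes X :: "'x topology" and \<mu> :: "'x measure"
    and \<phi> \<psi> :: "'x \<Rightarrow> 'h::complex_hilbert_space"
  assumes "separable_space (euclidean :: 'h topology)"
    and "locally_compact_space X" and "Hausdorff_space X"
    and "radon_measure_on X \<mu>"
    and "lower_semi_frame \<mu> \<phi>"
    and "\<And>x. x \<in> topspace X \<Longrightarrow>
           \<psi> x = op_apply ((gen_frame_op \<mu> \<phi>)\<inverse>) (orth_proj (analysis_space \<mu> \<phi>) (\<phi> x))"
  shows "weakly_measurable \<mu> \<psi> \<and>
         bessel_mapping \<mu> \<psi> \<and>
         dual_to \<mu> \<psi> \<phi> \<and>
         (closure (analysis_dom \<mu> \<phi>) = UNIV \<longrightarrow> upper_semi_frame \<mu> \<psi>)"
proof -
  let ?D = "analysis_dom \<mu> \<phi>" and ?\<Omega> = "frame_form \<mu> \<phi>"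
  have wm: "weakly_measurable \<mu> \<phi>" using assms(5) by (simp add: lower_semi_frame_def)
  obtain m where m: "m > 0" "\<And>f. f \<in> ?D \<Longrightarrow> m * (norm f)\<^sup>2 \<le> Re (?\<Omega> f f)"
    using lower_semi_frame_coercive[OF assms(5)] by blast
  obtain A where A: "\<And>h. A h \<in> ?D" "\<And>h g. g \<in> ?D \<Longrightarrow> ?\<Omega> (A h) g = cinner h g"
    using frame_form_representation[OF assms(5)] by metis
  have psi: "\<psi> x = A (\<phi> x)" if "x \<in> space \<mu>" for x
    using that assms(4,6) gen_frame_op_inverse[OF assms(5) A] by (simp add: radon_measure_on_def)
  have A_symmetric: "cinner h (A k) = cinner (A h) k" for h k
    using A(2)[OF A(1), of h k] A(2)[OF A(1), of k h] frame_form_commute[of \<mu> \<phi> "A h" "A k"]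
      cinner_commute[of k "A h"] by simp
  have coeff: "cinner f (\<psi> x) = cinner (A f) (\<phi> x)" if "x \<in> space \<mu>" for f x
    using psi[OF that] A_symmetric by simp

  have meas: "weakly_measurable \<mu> \<psi>"
    using wm by (simp add: weakly_measurable_def coeff cong: measurable_cong)

  have "(\<integral>\<^sup>+x. ennreal ((cmod (cinner f (\<psi> x)))\<^sup>2) \<partial>\<mu>) \<le> ennreal (1 / m * (norm f)\<^sup>2)" for f
  proof -
    have le: "Re (?\<Omega> (A f) (A f)) \<le> norm f * norm (A f)"
      using A complex_Re_le_cmod norm_cinner_le by (metis order_trans)
    have "m * norm (A f) \<le> norm f"
    proof (cases "A f = 0")
      case False
      have "m * norm (A f) * norm (A f) \<le> norm f * norm (A f)"
        using m(2)[OF A(1), of f] le by (simp add: power2_eq_square)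
      then show ?thesis using False by simp
    qed simp
    then have "norm f * norm (A f) \<le> norm f * (norm f / m)"
      using m(1) by (intro mult_left_mono) (auto simp: field_simps)
    with le have bound: "Re (?\<Omega> (A f) (A f)) \<le> 1 / m * (norm f)\<^sup>2"
      by (simp add: power2_eq_square)
    have "(\<integral>\<^sup>+x. ennreal ((cmod (cinner f (\<psi> x)))\<^sup>2) \<partial>\<mu>)
        = (\<integral>\<^sup>+x. ennreal ((cmod (cinner (A f) (\<phi> x)))\<^sup>2) \<partial>\<mu>)"
      by (intro nn_integral_cong) (simp add: coeff)
    also have "\<dots> = ennreal (Re (?\<Omega> (A f) (A f)))"
      by (rule nn_integral_eq_frame_form(1)[OF wm A(1)])
    also have "\<dots> \<le> ennreal (1 / m * (norm f)\<^sup>2)"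
      using bound by (rule ennreal_leI)
    finally show ?thesis .
  qed
  then have bessel: "bessel_mapping \<mu> \<psi>"
    unfolding bessel_mapping_def using meas m(1) by (intro conjI exI[of _ "1 / m"]) auto

  have dual: "dual_to \<mu> \<psi> \<phi>"
    unfolding dual_to_def
  proof (intro ballI allI)
    fix f h assume f: "f \<in> ?D"
    have "?\<Omega> f (A h) = cinner f h"
      using A(2)[OF f, of h] frame_form_commute[of \<mu> \<phi> f "A h"] cinner_commute[of f h] by simp
    then have "has_bochner_integral \<mu> (\<lambda>x. cinner f (\<phi> x) * cinner (\<phi> x) (A h)) (cinner f h)"
      using frame_form_integrable[OF wm f A(1)]
      by (simp add: has_bochner_integral_iff frame_form_def)
    moreover have "cinner (\<psi> x) h = cinner (\<phi> x) (A h)" if "x \<in> space \<mu>" for x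
      using psi[OF that] A_symmetric by simp
    ultimately show "has_bochner_integral \<mu> (\<lambda>x. cinner f (\<phi> x) * cinner (\<psi> x) h) (cinner f h)"
      by (simp cong: has_bochner_integral_cong)
  qed

  have "f = 0" if dense: "closure ?D = UNIV" and zero: "AE x in \<mu>. cinner f (\<psi> x) = 0" for f
  proof (rule eq_0_if_orthogonal_to_dense)
    show "f \<in> closure ?D" using dense by simp
    fix g assume g: "g \<in> ?D"
    have "AE x in \<mu>. cinner (A f) (\<phi> x) * cinner (\<phi> x) g = 0"
      using zero by (rule AE_mp) (intro AE_I2, simp add: coeff)
    then have "?\<Omega> (A f) g = 0"
      unfolding frame_form_def by (rule integral_eq_zero_AE)
    then show "cinner f g = 0" using A(2)[OF g] by simp
  qed
  then have "closure ?D = UNIV \<longrightarrow> upper_semi_frame \<mu> \<psi>"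
    using meas bessel by (auto simp: upper_semi_frame_def mu_total_def)
  with meas bessel dual show ?thesis by blast
qed

end
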